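(* Let $n\ge1$. For every integer $M>2n$ there exists a residual set $Q\subset (C^\infty(\mathbb{T};\mathbb{R}^2))^{2nM}$ such that for every $(f_{a,i})_{a=1,\dots,M,\ i=1,\dots,2n}\in Q$ one has $$\operatorname{span}\{A_{f_{a,i}}(x)\}_{a=1,\dots,M,\ i=1,\dots,2n}=\mathbb{R}^{2n}\qquad\text{for every }x\in\Gamma^c .$$
   Context: $\mathbb{T}=\mathbb{R}^2/(2\pi\mathbb{Z}^2)$ is the two-dimensional torus. $C^\infty(\mathbb{T};\mathbb{R}^2)$ is the space of smooth vector fields on $\mathbb{T}$ with its usual $C^\infty$ (Fréchet) topology, and products carry the product topology. A residual set is a countable intersection of open dense sets. $\Gamma=\{(x^1,\dots,x^n)\in\mathbb{T}^n:\ x^i=x^j\text{ for some }i\ne j\}$ and $\Gamma^c=\mathbb{T}^n\setminus\Gamma$. For a vector field $f:\mathbb{T}\to\mathbb{R}^2$, $A_f$ is the vector field on $\mathbb{T}^n$ given by $A_f(x^1,\dots,x^n)=(f(x^1),\dots,f(x^n))\in\mathbb{R}^{2n}$. *)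

theory Defs
  imports "HOL-Analysis.Analysis"
begin

definition torus_rel :: "real^2 \<Rightarrow> real^2 \<Rightarrow> bool" where
  "torus_rel x y \<longleftrightarrow> (\<forall>k. \<exists>m::int. x $ k - y $ k = 2 * pi * of_int m)"

lemma equivp_torus_rel: "equivp torus_rel"
proof (rule equivpI)
  show "reflp torus_rel"
    unfolding torus_rel_def by (intro reflpI allI exI[of _ 0]) simp
  show "symp torus_rel"
  proof (rule sympI, unfold torus_rel_def, rule allI)
    fix x y :: "real^2" and k
    assume "\<forall>k. \<exists>m::int. x $ k - y $ k = 2 * pi * of_int m"
    then obtain m :: int where "x $ k - y $ k = 2 * pi * of_int m" by blast
    then have "y $ k - x $ k = 2 * pi * of_int (- m)" by simp
    then show "\<exists>m::int. y $ k - x $ k = 2 * pi * of_int m" by blast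
  qed
  show "transp torus_rel"
  proof (rule transpI, unfold torus_rel_def, rule allI)
    fix x y z :: "real^2" and k
    assume "\<forall>k. \<exists>m::int. x $ k - y $ k = 2 * pi * of_int m"
      and "\<forall>k. \<exists>m::int. y $ k - z $ k = 2 * pi * of_int m"
    then obtain m l :: int where "x $ k - y $ k = 2 * pi * of_int m"
      and "y $ k - z $ k = 2 * pi * of_int l" by blast
    then have "x $ k - z $ k = 2 * pi * of_int (m + l)" by (simp add: distrib_left)
    then show "\<exists>m::int. x $ k - z $ k = 2 * pi * of_int m" by blast
  qed
qed

quotient_type torus = "real^2" / torus_rel
  by (rule equivp_torus_rel)

text \<open>A vector field on the torus is a function \<open>torus \<Rightarrow> real^2\<close> (the tangent bundle is
  trivial). Differential notions are read off on its periodic lift to the plane.\<close>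

definition lift_field :: "(torus \<Rightarrow> real^2) \<Rightarrow> real^2 \<Rightarrow> real^2" where
  "lift_field f = (\<lambda>x. f (abs_torus x))"

definition partial_deriv :: "2 \<Rightarrow> (real^2 \<Rightarrow> real^2) \<Rightarrow> real^2 \<Rightarrow> real^2" where
  "partial_deriv k F x = frechet_derivative F (at x) (axis k 1)"

primrec partial_derivs :: "2 list \<Rightarrow> (real^2 \<Rightarrow> real^2) \<Rightarrow> real^2 \<Rightarrow> real^2" where
  "partial_derivs [] F = F"
| "partial_derivs (k # ks) F = partial_deriv k (partial_derivs ks F)"

text \<open>Requiring every iterated partial derivative to be differentiable makes all of them
  exist and be continuous, and conversely.\<close>

definition smooth_field :: "(torus \<Rightarrow> real^2) \<Rightarrow> bool" where
  "smooth_field f \<longleftrightarrow> (\<forall>ks. partial_derivs ks (lift_field f) differentiable_on UNIV)"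

text \<open>The supremum is finite for smooth fields, since the lift and all its derivatives are
  continuous and periodic.\<close>

definition Ck_norm :: "nat \<Rightarrow> (torus \<Rightarrow> real^2) \<Rightarrow> real" where
  "Ck_norm k f =
     (SUP (ks, x) \<in> {ks. length ks \<le> k} \<times> UNIV. norm (partial_derivs ks (lift_field f) x))"

definition Ck_ball :: "(torus \<Rightarrow> real^2) \<Rightarrow> nat \<Rightarrow> real \<Rightarrow> (torus \<Rightarrow> real^2) set" where
  "Ck_ball f k e = {g. smooth_field g \<and> Ck_norm k (\<lambda>x. g x - f x) < e}"

definition smooth_fields_topology :: "(torus \<Rightarrow> real^2) topology" where
  "smooth_fields_topology =
     topology_generated_by {Ck_ball f k e |f k e. smooth_field f \<and> 0 < e}"

lemma partial_derivs_zero: "partial_derivs ks (\<lambda>x. 0) = (\<lambda>x. 0)"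
proof (induction ks)
  case (Cons k ks)
  have "frechet_derivative (\<lambda>x. 0 :: real^2) (at x) = (\<lambda>h. 0)" for x :: "real^2"
    by (rule frechet_derivative_at [symmetric]) (rule has_derivative_const)
  then show ?case
    unfolding partial_derivs.simps Cons.IH partial_deriv_def by (rule_tac ext) simp
qed simp

lemma Ck_norm_zero: "Ck_norm k (\<lambda>x. 0) = 0"
proof -
  have "lift_field (\<lambda>x. 0) = (\<lambda>x. 0)"
    by (simp add: lift_field_def)
  then have "Ck_norm k (\<lambda>x. 0) = (SUP p \<in> {ks :: 2 list. length ks \<le> k} \<times> (UNIV :: (real^2) set). 0)"
    unfolding Ck_norm_def by (simp add: partial_derivs_zero split_beta)
  moreover have "([], 0) \<in> {ks :: 2 list. length ks \<le> k} \<times> (UNIV :: (real^2) set)"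
    by simp
  ultimately show ?thesis
    by (metis cSUP_const empty_iff)
qed

lemma topspace_smooth_fields: "topspace smooth_fields_topology = Collect smooth_field"
proof -
  have "f \<in> Ck_ball f 0 1" if "smooth_field f" for f
    using that by (simp add: Ck_ball_def Ck_norm_zero)
  then have "Collect smooth_field \<subseteq> \<Union> {Ck_ball f k e |f k e. smooth_field f \<and> 0 < e}"
    using zero_less_one by blast
  moreover have "\<Union> {Ck_ball f k e |f k e. smooth_field f \<and> 0 < e} \<subseteq> Collect smooth_field"
    unfolding Ck_ball_def by blast
  ultimately show ?thesis
    unfolding smooth_fields_topology_def by simp
qed

definition residual_in :: "'a topology \<Rightarrow> 'a set \<Rightarrow> bool" where
  "residual_in X Q \<longleftrightarrow>
     (\<exists>\<U>. countable \<U> \<and> (\<forall>U\<in>\<U>. openin X U \<and> X closure_of U = topspace X)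
          \<and> Q = topspace X \<inter> \<Inter>\<U>)"

text \<open>Points of the \<open>n\<close>-fold product of the torus are elements of \<open>torus^'n\<close> with
  \<open>n = CARD('n)\<close>, and \<open>real^2^'n\<close> is the \<open>2n\<close>-dimensional tangent space.\<close>

definition fat_diagonal :: "(torus^'n) set" where
  "fat_diagonal = {x. \<exists>i j. i \<noteq> j \<and> x $ i = x $ j}"

definition diag_field :: "(torus \<Rightarrow> real^2) \<Rightarrow> torus^'n \<Rightarrow> real^2^'n" where
  "diag_field f x = (\<chi> j. f (x $ j))"

end

theory Submission
  imports Defs
begin

text \<open>
  Write \<open>n = CARD('n)\<close>. The vectors \<open>A_f(x)\<close>, taken over the fields \<open>f\<close> of the family, fail to span
  \<open>\<real>^(2n)\<close> exactly when some covector \<open>v \<noteq> 0\<close> is orthogonal to all of them. Hence the failure at some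
  \<open>x\<close> off the fat diagonal is the solvability of one scalar equation \<open>v \<bullet> A_f(x) = 0\<close> per field in an
  unknown \<open>(x, v)\<close> of only \<open>4n\<close> real dimensions. The family has \<open>2nM > 4n\<close> members, so the system is
  overdetermined and a generic family should admit no solution.

  The complement of the fat diagonal is exhausted by countably many compact sets: configurations
  whose points keep a distance from each other that is bounded below (\<open>separated_points\<close>). For each
  of them the families that span at all its points form a \<open>C\<^sup>0\<close>-open, hence open, set, because the
  continuous function \<open>\<Sum>\<bar>v \<bullet> A_f(x)\<bar>\<close> has a positive minimum over \<open>x\<close> in the compact set and unit
  vectors \<open>v\<close> (\<open>openin_spans_at_compact\<close>). The residual set is the intersection of these open sets.

  Density (\<open>dense_spans_at_distinct\<close>) comes from a finite-dimensional perturbation. Trigonometric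
  polynomials interpolate arbitrary values at \<open>n\<close> distinct points of the torus, so finitely many fixed
  fields \<open>h_l\<close> already span at every \<open>x\<close> off the diagonal (\<open>trig_fields_span\<close>). Add to each of
  \<open>4n + 1\<close> members \<open>f_p\<close> of a given family a combination \<open>\<Sum> c_(p,l) h_l\<close>. The coefficients \<open>c\<close> for which
  spanning still fails somewhere solve \<open>4n + 1\<close> equations, each of them affine in its own row of \<open>c\<close>
  with coefficients \<open>v \<bullet> A_(h_l)(x)\<close> that do not all vanish. Solving for one column of \<open>c\<close> exhibits
  them as a smooth image of a space with one parameter less, hence as a null set
  (\<open>negligible_solvable_parameters\<close>). As \<open>c\<close> tends to \<open>0\<close>, the perturbed family tends to the given one
  in the smooth topology (\<open>continuous_map_smooth_fields_perturbation\<close>), so arbitrarily small good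
  perturbations exist.
\<close>

section \<open>Overdetermined systems with generic coefficients\<close>

lemma differentiable_vec_lambda:
  fixes f :: "'a::real_normed_vector \<Rightarrow> 'i::finite \<Rightarrow> 'b::euclidean_space"
  assumes "\<And>i. (\<lambda>x. f x i) differentiable (at a within S)"
  shows "(\<lambda>x. \<chi> i. f x i) differentiable (at a within S)"
proof -
  have "(\<lambda>x. f x i \<bullet> u) differentiable (at a within S)" for i u
    using assms[of i] by (intro differentiable_inner) auto
  then show ?thesis
    by (subst differentiable_componentwise_within) (auto simp: Basis_vec_def inner_axis)
qed

text \<open>A parameter-counting form of transversality. Where \<open>\<beta> l z \<noteq> 0\<close>, the equations determine the \<open>l\<close>-th
  column of \<open>c\<close>, one entry for each \<open>p\<close>, from \<open>z\<close> and the other columns. A column has more than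
  \<open>DIM('e)\<close> entries, so it can store \<open>z\<close> and still carry a \<open>0\<close> at some spare position \<open>p0\<close>: the solvable
  \<open>c\<close> are covered by differentiable images of subsets of hyperplanes of the very same space.\<close>

lemma negligible_solvable_parameters:
  fixes \<alpha> :: "'p::finite \<Rightarrow> 'e::euclidean_space \<Rightarrow> real"
    and \<beta> :: "'l::finite \<Rightarrow> 'e \<Rightarrow> real"
  assumes diff: "\<And>p z. \<alpha> p differentiable at z" "\<And>l z. \<beta> l differentiable at z"
    and dim: "DIM('e) < CARD('p)"
  shows "negligible {c :: real^'l^'p. \<exists>z. (\<exists>l. \<beta> l z \<noteq> 0) \<and> (\<forall>p. \<alpha> p z + (\<Sum>l\<in>UNIV. c $ p $ l * \<beta> l z) = 0)}"
proof -
  obtain \<iota> :: "'e \<Rightarrow> 'p" where \<iota>: "inj_on \<iota> Basis"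
    using card_le_inj[of "Basis :: 'e set" "UNIV :: 'p set"] dim by auto
  have "card (\<iota> ` Basis) < CARD('p)"
    using dim by (simp add: card_image \<iota>)
  then obtain p0 where p0: "p0 \<notin> \<iota> ` Basis"
    by (metis UNIV_eq_I less_irrefl)
  \<comment> \<open>\<open>T l\<close> reads \<open>z\<close> off the \<open>l\<close>-th column; \<open>F l\<close> overwrites that column by the solution of the equations.\<close>
  define T where "T l d = (\<Sum>b\<in>Basis. (d $ \<iota> b $ l) *\<^sub>R b)" for l and d :: "real^'l^'p"
  define S where "S l = {d :: real^'l^'p. d $ p0 $ l = 0 \<and> \<beta> l (T l d) \<noteq> 0}" for l
  define F where "F l d = (\<chi> p. \<chi> m. if m \<noteq> l then d $ p $ m else
      - (\<alpha> p (T l d) + (\<Sum>k\<in>UNIV - {l}. d $ p $ k * \<beta> k (T l d))) / \<beta> l (T l d))"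
    for l and d :: "real^'l^'p"
  have coord: "bounded_linear (\<lambda>d :: real^'l^'p. d $ p $ m)" for p m
    by (rule bounded_linear_compose[OF bounded_linear_vec_nth bounded_linear_vec_nth])
  have coord_diff: "(\<lambda>d :: real^'l^'p. d $ p $ m) differentiable (at d within D)" for p m d D
    using coord by (rule bounded_linear_imp_differentiable)
  have T_diff: "T l differentiable (at d within D)" for l d D
    unfolding T_def[abs_def]
    by (intro bounded_linear_imp_differentiable bounded_linear_sum bounded_linear_scaleR_const coord)
  have \<alpha>T: "(\<lambda>d. \<alpha> p (T l d)) differentiable (at d within D)" for p l d D
    by (rule differentiable_compose[OF diff(1) T_diff])
  have \<beta>T: "(\<lambda>d. \<beta> k (T l d)) differentiable (at d within D)" for k l d D
    by (rule differentiable_compose[OF diff(2) T_diff])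
  have F_diff: "F l differentiable_on S l" for l
    unfolding differentiable_on_def
  proof
    fix d assume d: "d \<in> S l"
    have "(\<lambda>d. if m \<noteq> l then d $ p $ m else
      - (\<alpha> p (T l d) + (\<Sum>k\<in>UNIV - {l}. d $ p $ k * \<beta> k (T l d))) / \<beta> l (T l d))
        differentiable (at d within S l)" for p m
    proof (cases "m = l")
      case True
      have "(\<lambda>d. - (\<alpha> p (T l d) + (\<Sum>k\<in>UNIV - {l}. d $ p $ k * \<beta> k (T l d))) / \<beta> l (T l d))
          differentiable (at d within S l)"
        using d by (intro differentiable_divide differentiable_minus differentiable_add
            differentiable_sum ballI differentiable_mult \<alpha>T \<beta>T coord_diff) (auto simp: S_def)
      then show ?thesis
        using True by simp
    qed (simp add: coord_diff)
    then show "F l differentiable (at d within S l)"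
      unfolding F_def[abs_def] by (intro differentiable_vec_lambda)
  qed
  have S_neg: "negligible (S l)" for l
  proof (rule negligible_subset)
    show "negligible {d :: real^'l^'p. axis p0 (axis l 1) \<bullet> d = 0}"
      by (rule negligible_hyperplane) (simp add: axis_eq_0_iff)
    show "S l \<subseteq> {d. axis p0 (axis l 1) \<bullet> d = 0}"
      by (auto simp: S_def inner_axis')
  qed
  have "negligible (F l ` S l)" for l
    by (rule negligible_differentiable_image_negligible[OF order_refl S_neg F_diff])
  then have "negligible (\<Union>l. F l ` S l)"
    by (intro negligible_Union) auto
  moreover have "{c. \<exists>z. (\<exists>l. \<beta> l z \<noteq> 0) \<and> (\<forall>p. \<alpha> p z + (\<Sum>l\<in>UNIV. c $ p $ l * \<beta> l z) = 0)}
      \<subseteq> (\<Union>l. F l ` S l)"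
  proof clarify
    fix c z l
    assume nz: "\<beta> l z \<noteq> 0" and eq: "\<forall>p. \<alpha> p z + (\<Sum>l\<in>UNIV. c $ p $ l * \<beta> l z) = 0"
    define u where "u p = (if p \<in> \<iota> ` Basis then z \<bullet> the_inv_into Basis \<iota> p else 0)" for p
    define d where "d = (\<chi> p. \<chi> m. if m = l then u p else c $ p $ m)"
    have "u (\<iota> b) = z \<bullet> b" if "b \<in> Basis" for b
      using that by (simp add: u_def the_inv_into_f_f \<iota>)
    then have Td: "T l d = z"
      by (simp add: T_def d_def euclidean_representation)
    have "F l d $ p $ m = c $ p $ m" for p m
    proof (cases "m = l")
      case True
      have "\<alpha> p z + (c $ p $ l * \<beta> l z + (\<Sum>k\<in>UNIV - {l}. c $ p $ k * \<beta> k z)) = 0"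
        using eq by (subst sum.remove[symmetric]) auto
      then have "- (\<alpha> p z + (\<Sum>k\<in>UNIV - {l}. c $ p $ k * \<beta> k z)) = c $ p $ l * \<beta> l z"
        by simp
      moreover have "(\<Sum>k\<in>UNIV - {l}. d $ p $ k * \<beta> k z) = (\<Sum>k\<in>UNIV - {l}. c $ p $ k * \<beta> k z)"
        by (rule sum.cong) (auto simp: d_def)
      ultimately show ?thesis
        using nz True by (simp add: F_def Td)
    qed (simp add: F_def d_def)
    then have "F l d = c"
      by (simp add: vec_eq_iff)
    moreover have "d \<in> S l"
      using p0 nz by (simp add: S_def Td) (simp add: d_def u_def)
    ultimately show "c \<in> (\<Union>l. F l ` S l)"
      by blast
  qed
  ultimately show ?thesis
    by (rule negligible_subset)
qed

section \<open>Periodicity and \<open>C\<^sup>k\<close> norms of smooth fields\<close>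

lemma abs_torus_cong: "torus_rel x y \<Longrightarrow> abs_torus x = abs_torus y"
  by (simp add: torus.abs_eq_iff)

text \<open>Translation preserves derivatives, so the choice operator inside \<open>frechet_derivative\<close> picks the same
  value at both points, even where no derivative exists.\<close>

lemma partial_derivs_shift:
  assumes "\<And>x. F (x + t) = F x"
  shows "partial_derivs ks F (x + t) = partial_derivs ks F x"
proof (induction ks arbitrary: x)
  case Nil
  then show ?case by (simp add: assms)
next
  case (Cons k ks)
  let ?G = "partial_derivs ks F"
  have "(?G has_derivative D) (at (x + t)) \<longleftrightarrow> (?G has_derivative D) (at x)" for D
  proof
    assume "(?G has_derivative D) (at (x + t))"
    then have "((\<lambda>y. ?G (y + t)) has_derivative D) (at x)"
      by (rule has_derivative_compose[rotated, where f = "\<lambda>y. y + t" and f' = "\<lambda>h. h", simplified])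
         (auto intro!: derivative_eq_intros)
    then show "(?G has_derivative D) (at x)"
      by (simp add: Cons.IH)
  next
    assume *: "(?G has_derivative D) (at x)"
    have "((\<lambda>y. ?G (y + - t)) has_derivative D) (at (x + t))"
      by (rule has_derivative_compose[where f = "\<lambda>y. y + - t" and f' = "\<lambda>h. h" and g = "?G"])
         (use * in \<open>auto intro!: derivative_eq_intros\<close>)
    moreover have "?G (y + - t) = ?G y" for y
      using Cons.IH[of "y + - t"] by simp
    ultimately show "(?G has_derivative D) (at (x + t))"
      by simp
  qed
  then show ?case
    by (simp add: partial_deriv_def frechet_derivative_def)
qed

lemma partial_derivs_periodic:
  assumes "torus_rel x y"
  shows "partial_derivs ks (lift_field f) x = partial_derivs ks (lift_field f) y"
proof -
  have "lift_field f (z + (x - y)) = lift_field f z" for z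
    unfolding lift_field_def
    by (rule arg_cong[where f = f], rule abs_torus_cong)
      (use assms in \<open>simp add: torus_rel_def\<close>)
  from partial_derivs_shift[of "lift_field f", OF this, of ks y] show ?thesis
    by simp
qed

lemma fundamental_domain:
  obtains y :: "real^2" where "torus_rel x y" "y \<in> cbox 0 (\<chi> k. 2 * pi)"
proof
  let ?y = "\<chi> k. x $ k - 2 * pi * of_int \<lfloor>x $ k / (2 * pi)\<rfloor>"
  show "torus_rel x ?y"
    by (auto simp: torus_rel_def)
  have "0 \<le> x $ k - 2 * pi * of_int \<lfloor>x $ k / (2 * pi)\<rfloor>
      \<and> x $ k - 2 * pi * of_int \<lfloor>x $ k / (2 * pi)\<rfloor> \<le> 2 * pi" for k
  proof -
    define r where "r = x $ k / (2 * pi)"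
    have x: "x $ k = 2 * pi * r"
      by (simp add: r_def)
    have "2 * pi * of_int \<lfloor>r\<rfloor> \<le> 2 * pi * r" "2 * pi * r \<le> 2 * pi * (of_int \<lfloor>r\<rfloor> + 1)"
      by (intro mult_left_mono; simp; linarith)+
    then show ?thesis
      unfolding r_def[symmetric] x by (simp add: algebra_simps)
  qed
  then show "?y \<in> cbox 0 (\<chi> k. 2 * pi)"
    by (auto simp: mem_box_cart)
qed

text \<open>By periodicity all values are taken on a compact fundamental domain. This makes the suprema in
  \<open>Ck_norm\<close> genuine ones.\<close>

lemma smooth_field_bounded:
  assumes "smooth_field f"
  shows "bounded (range (partial_derivs ks (lift_field f)))"
proof -
  let ?G = "partial_derivs ks (lift_field f)"
  have "continuous_on (cbox 0 (\<chi> k. 2 * pi)) ?G"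
    using assms unfolding smooth_field_def
    by (intro continuous_on_subset[OF differentiable_imp_continuous_on subset_UNIV]) simp
  then have "bounded (?G ` cbox 0 (\<chi> k. 2 * pi))"
    by (intro compact_imp_bounded compact_continuous_image compact_cbox)
  moreover have "range ?G \<subseteq> ?G ` cbox 0 (\<chi> k. 2 * pi)"
  proof clarify
    fix x
    obtain y where "torus_rel x y" "y \<in> cbox 0 (\<chi> k. 2 * pi)"
      by (rule fundamental_domain)
    then show "?G x \<in> ?G ` cbox 0 (\<chi> k. 2 * pi)"
      using partial_derivs_periodic by blast
  qed
  ultimately show ?thesis
    by (rule bounded_subset)
qed

lemma smooth_field_Ck_bdd_above:
  assumes "smooth_field f"
  shows "bdd_above ((\<lambda>(ks, x). norm (partial_derivs ks (lift_field f) x)) ` ({ks. length ks \<le> k} \<times> UNIV))"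
proof -
  have "finite {ks :: 2 list. length ks \<le> k}"
    using finite_lists_length_le[of "UNIV :: 2 set" k] by simp
  then have "bounded (\<Union>ks\<in>{ks. length ks \<le> k}. range (partial_derivs ks (lift_field f)))"
    using smooth_field_bounded[OF assms] by (intro bounded_UN) auto
  then obtain B where "\<forall>y\<in>(\<Union>ks\<in>{ks. length ks \<le> k}. range (partial_derivs ks (lift_field f))). norm y \<le> B"
    by (auto simp: bounded_iff)
  then show ?thesis
    by (intro bdd_aboveI[of _ B]) auto
qed

lemma norm_partial_derivs_le_Ck_norm:
  assumes "smooth_field f" "length ks \<le> k"
  shows "norm (partial_derivs ks (lift_field f) x) \<le> Ck_norm k f"
proof -
  have "(ks, x) \<in> {ks. length ks \<le> k} \<times> UNIV"
    using assms(2) by simp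
  from cSUP_upper[OF this smooth_field_Ck_bdd_above[OF assms(1)]] show ?thesis
    by (simp only: Ck_norm_def prod.case)
qed

lemma Ck_norm_le:
  assumes "\<And>ks x. length ks \<le> k \<Longrightarrow> norm (partial_derivs ks (lift_field f) x) \<le> B"
  shows "Ck_norm k f \<le> B"
proof -
  have "([], 0) \<in> {ks :: 2 list. length ks \<le> k} \<times> (UNIV :: (real^2) set)"
    by simp
  then show ?thesis
    unfolding Ck_norm_def using assms by (intro cSUP_least) (blast, clarsimp)
qed

lemma partial_derivs_lincomb:
  assumes F: "\<And>ks. partial_derivs ks F differentiable_on UNIV"
    and G: "\<And>ks. partial_derivs ks G differentiable_on UNIV"
  shows "partial_derivs ks (\<lambda>x. F x + r *\<^sub>R G x) = (\<lambda>x. partial_derivs ks F x + r *\<^sub>R partial_derivs ks G x)"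
proof (induction ks)
  case (Cons k ks)
  have "frechet_derivative (\<lambda>x. partial_derivs ks F x + r *\<^sub>R partial_derivs ks G x) (at x) =
    (\<lambda>h. frechet_derivative (partial_derivs ks F) (at x) h + r *\<^sub>R frechet_derivative (partial_derivs ks G) (at x) h)" for x
  proof (rule frechet_derivative_at[symmetric])
    have "(partial_derivs ks F has_derivative frechet_derivative (partial_derivs ks F) (at x)) (at x)"
      "(partial_derivs ks G has_derivative frechet_derivative (partial_derivs ks G) (at x)) (at x)"
      using F[of ks] G[of ks] by (auto simp: differentiable_on_def frechet_derivative_works)
    then show "((\<lambda>x. partial_derivs ks F x + r *\<^sub>R partial_derivs ks G x) has_derivative
      (\<lambda>h. frechet_derivative (partial_derivs ks F) (at x) h + r *\<^sub>R frechet_derivative (partial_derivs ks G) (at x) h)) (at x)"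
      by (intro has_derivative_add has_derivative_scaleR_right)
  qed
  then show ?case
    by (simp add: Cons.IH partial_deriv_def)
qed simp

lemma lift_field_lincomb: "lift_field (\<lambda>x. f x + r *\<^sub>R g x) = (\<lambda>x. lift_field f x + r *\<^sub>R lift_field g x)"
  by (simp add: lift_field_def)

lemma partial_derivs_field_lincomb:
  assumes "smooth_field f" "smooth_field g"
  shows "partial_derivs ks (lift_field (\<lambda>x. f x + r *\<^sub>R g x)) x
    = partial_derivs ks (lift_field f) x + r *\<^sub>R partial_derivs ks (lift_field g) x"
  using assms by (simp add: lift_field_lincomb partial_derivs_lincomb smooth_field_def)

lemma smooth_field_lincomb:
  assumes "smooth_field f" "smooth_field g"
  shows "smooth_field (\<lambda>x. f x + r *\<^sub>R g x)"
  unfolding smooth_field_def differentiable_on_def partial_derivs_field_lincomb[OF assms, abs_def]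
  using assms by (auto simp: smooth_field_def differentiable_on_def intro!: differentiable_add differentiable_scaleR)

text \<open>Triangle inequality and homogeneity at once, in the form that suits adding a linear combination term
  by term.\<close>

lemma Ck_norm_lincomb:
  assumes "smooth_field f" "smooth_field g"
  shows "Ck_norm k (\<lambda>x. f x + r *\<^sub>R g x) \<le> Ck_norm k f + \<bar>r\<bar> * Ck_norm k g"
proof (rule Ck_norm_le)
  fix ks :: "2 list" and x :: "real^2" assume ks: "length ks \<le> k"
  have "norm (partial_derivs ks (lift_field f) x + r *\<^sub>R partial_derivs ks (lift_field g) x)
    \<le> norm (partial_derivs ks (lift_field f) x) + \<bar>r\<bar> * norm (partial_derivs ks (lift_field g) x)"
    using norm_triangle_ineq[of "partial_derivs ks (lift_field f) x" "r *\<^sub>R partial_derivs ks (lift_field g) x"] by simp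
  also have "\<dots> \<le> Ck_norm k f + \<bar>r\<bar> * Ck_norm k g"
    by (intro add_mono mult_left_mono norm_partial_derivs_le_Ck_norm assms ks) auto
  finally show "norm (partial_derivs ks (lift_field (\<lambda>x. f x + r *\<^sub>R g x)) x) \<le> Ck_norm k f + \<bar>r\<bar> * Ck_norm k g"
    by (simp add: partial_derivs_field_lincomb assms)
qed

lemma smooth_field_diff:
  assumes "smooth_field f" "smooth_field g"
  shows "smooth_field (\<lambda>x. f x - g x)"
  using smooth_field_lincomb[OF assms, of "-1"] by simp

lemma smooth_field_add_sum:
  assumes "smooth_field f" "\<And>l. l \<in> A \<Longrightarrow> smooth_field (h l)" "finite A"
  shows "smooth_field (\<lambda>x. f x + (\<Sum>l\<in>A. c l *\<^sub>R h l x))"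
  using assms(3,1,2)
proof (induction A)
  case (insert l A)
  then have "smooth_field (\<lambda>x. (f x + (\<Sum>l\<in>A. c l *\<^sub>R h l x)) + c l *\<^sub>R h l x)"
    by (intro smooth_field_lincomb) auto
  with insert.hyps show ?case
    by (simp add: algebra_simps)
qed simp

lemma Ck_norm_add_sum:
  assumes "smooth_field f" "\<And>l. l \<in> A \<Longrightarrow> smooth_field (h l)" "finite A"
  shows "Ck_norm k (\<lambda>x. f x + (\<Sum>l\<in>A. c l *\<^sub>R h l x)) \<le> Ck_norm k f + (\<Sum>l\<in>A. \<bar>c l\<bar> * Ck_norm k (h l))"
  using assms(3,1,2)
proof (induction A)
  case (insert l A)
  have "Ck_norm k (\<lambda>x. (f x + (\<Sum>l\<in>A. c l *\<^sub>R h l x)) + c l *\<^sub>R h l x)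
    \<le> Ck_norm k (\<lambda>x. f x + (\<Sum>l\<in>A. c l *\<^sub>R h l x)) + \<bar>c l\<bar> * Ck_norm k (h l)"
    using insert by (intro Ck_norm_lincomb smooth_field_add_sum) auto
  also have "Ck_norm k (\<lambda>x. f x + (\<Sum>l\<in>A. c l *\<^sub>R h l x)) \<le> Ck_norm k f + (\<Sum>l\<in>A. \<bar>c l\<bar> * Ck_norm k (h l))"
    using insert by auto
  finally show ?case
    using insert.hyps by (simp add: algebra_simps)
qed simp

text \<open>Since the balls only generate the topology, continuity is checked on each ball, also when its
  centre \<open>g\<close> is not the field at hand. When the coefficients move from \<open>c\<close> to \<open>d\<close>, the distance to \<open>g\<close>
  grows by at most \<open>\<Sum> \<bar>d l - c l\<bar> * Ck_norm k (h l)\<close>.\<close>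

lemma continuous_map_smooth_fields_perturbation:
  fixes h :: "'l::finite \<Rightarrow> torus \<Rightarrow> real^2"
  assumes f: "smooth_field f" and h: "\<And>l. smooth_field (h l)"
  shows "continuous_map euclidean smooth_fields_topology (\<lambda>c::real^'l. \<lambda>x. f x + (\<Sum>l\<in>UNIV. c $ l *\<^sub>R h l x))"
proof -
  let ?P = "\<lambda>c::real^'l. \<lambda>x. f x + (\<Sum>l\<in>UNIV. c $ l *\<^sub>R h l x)"
  have smooth: "smooth_field (?P c)" for c
    by (intro smooth_field_add_sum f h) auto
  have "open (?P -` Ck_ball g k e)" if g: "smooth_field g" for g k e
  proof (subst open_subopen, intro ballI)
    fix c assume "c \<in> ?P -` Ck_ball g k e"
    then have c: "Ck_norm k (\<lambda>x. ?P c x - g x) < e"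
      by (simp add: Ck_ball_def)
    let ?T = "{d. Ck_norm k (\<lambda>x. ?P c x - g x) + (\<Sum>l\<in>UNIV. \<bar>d $ l - c $ l\<bar> * Ck_norm k (h l)) < e}"
    have "open ?T"
      by (intro open_Collect_less continuous_intros)
    moreover have "c \<in> ?T"
      using c by simp
    moreover have "?T \<subseteq> ?P -` Ck_ball g k e"
    proof
      fix d assume d: "d \<in> ?T"
      have "Ck_norm k (\<lambda>x. (?P c x - g x) + (\<Sum>l\<in>UNIV. (d $ l - c $ l) *\<^sub>R h l x)) < e"
        using Ck_norm_add_sum[OF smooth_field_diff[OF smooth[of c] g] h, of UNIV k "\<lambda>l. d $ l - c $ l" id] d
        by (simp add: id_def)
      moreover have "(\<lambda>x. (?P c x - g x) + (\<Sum>l\<in>UNIV. (d $ l - c $ l) *\<^sub>R h l x)) = (\<lambda>x. ?P d x - g x)"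
        by (auto simp: scaleR_left_diff_distrib sum_subtractf)
      ultimately show "d \<in> ?P -` Ck_ball g k e"
        using smooth by (simp add: Ck_ball_def)
    qed
    ultimately show "\<exists>T. open T \<and> c \<in> T \<and> T \<subseteq> ?P -` Ck_ball g k e"
      by blast
  qed
  moreover have "range ?P \<subseteq> topspace smooth_fields_topology"
    using smooth by (auto simp: topspace_smooth_fields)
  ultimately show ?thesis
    unfolding smooth_fields_topology_def
    by (subst continuous_on_generated_topo_iff) auto
qed

section \<open>Interpolation by trigonometric polynomials\<close>

text \<open>A squared distance on the torus, up to equivalence: half the squared Euclidean distance after the
  embedding of each circle factor into the plane. It is smooth and, in either argument, a trigonometric
  polynomial.\<close>

definition torus_gap :: "real^2 \<Rightarrow> real^2 \<Rightarrow> real" where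
  "torus_gap x y = (\<Sum>k\<in>UNIV. 1 - cos (x $ k - y $ k))"

lemma torus_gap_nonneg: "0 \<le> torus_gap x y"
  by (simp add: torus_gap_def sum_nonneg)

lemma torus_gap_eq_0_iff: "torus_gap x y = 0 \<longleftrightarrow> torus_rel x y"
proof -
  have "torus_gap x y = 0 \<longleftrightarrow> (\<forall>k. cos (x $ k - y $ k) = 1)"
    unfolding torus_gap_def by (subst sum_nonneg_eq_0_iff) auto
  then show ?thesis
    by (simp add: torus_rel_def cos_one_2pi_int mult_ac)
qed

text \<open>The five functions \<open>1\<close>, \<open>cos (x $ k)\<close>, \<open>sin (x $ k)\<close>, indexed by a finite type so that families of them can index
  coordinates of a vector space.\<close>

definition trig :: "(2 \<times> bool) option \<Rightarrow> real^2 \<Rightarrow> real" where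
  "trig t x = (case t of None \<Rightarrow> 1 | Some (k, b) \<Rightarrow> if b then cos (x $ k) else sin (x $ k))"

inductive trig_polynomial :: "(real^2 \<Rightarrow> real) \<Rightarrow> bool" where
  const: "trig_polynomial (\<lambda>x. r)"
| trig: "trig_polynomial (trig t)"
| add: "trig_polynomial g \<Longrightarrow> trig_polynomial h \<Longrightarrow> trig_polynomial (\<lambda>x. g x + h x)"
| mult: "trig_polynomial g \<Longrightarrow> trig_polynomial h \<Longrightarrow> trig_polynomial (\<lambda>x. g x * h x)"

lemma trig_polynomial_prod:
  assumes "finite A" "\<And>i. i \<in> A \<Longrightarrow> trig_polynomial (g i)"
  shows "trig_polynomial (\<lambda>x. \<Prod>i\<in>A. g i x)"
  using assms by (induction A) (auto intro: trig_polynomial.intros)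

lemma trig_polynomial_periodic:
  assumes "trig_polynomial g" "torus_rel x y"
  shows "g x = g y"
  using assms(1)
proof induction
  case (trig t)
  have "\<exists>m::int. x $ k = y $ k + 2 * pi * of_int m" for k
    using assms(2) unfolding torus_rel_def by (metis add.commute diff_add_cancel)
  then have "sin (x $ k) = sin (y $ k) \<and> cos (x $ k) = cos (y $ k)" for k
    by (subst sin_cos_eq_iff) blast
  then show ?case
    by (auto simp: trig_def split: option.split)
qed auto

lemma trig_polynomial_has_derivative:
  assumes "trig_polynomial g"
  shows "\<exists>D. (\<forall>k. trig_polynomial (D k)) \<and>
    (\<forall>x. (g has_derivative (\<lambda>h. \<Sum>k\<in>UNIV. D k x * h $ k)) (at x))"
  using assms
proof induction
  case (const r)
  show ?case
    by (intro exI[of _ "\<lambda>k x. 0"]) (auto intro: trig_polynomial.const)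
next
  case (trig t)
  show ?case
  proof (cases t)
    case None
    then show ?thesis
      by (intro exI[of _ "\<lambda>k x. 0"]) (auto simp: trig_def[abs_def] intro: trig_polynomial.const)
  next
    case (Some kb)
    obtain j b where kb: "kb = (j, b)"
      by fastforce
    let ?D = "\<lambda>k x. (if k = j then if b then - 1 else 1 else 0) * trig (Some (j, \<not> b)) x"
    have nth: "((\<lambda>x::real^2. x $ j) has_derivative (\<lambda>h. h $ j)) (at x)" for x
      by (rule bounded_linear_imp_has_derivative) (rule bounded_linear_vec_nth)
    have sum: "(\<Sum>k\<in>UNIV. ?D k x * h $ k) = (if b then - sin (x $ j) else cos (x $ j)) * h $ j" for x h :: "real^2"
      by (subst sum.remove[of _ j]) (auto simp: trig_def)
    have "(trig t has_derivative (\<lambda>h. \<Sum>k\<in>UNIV. ?D k x * h $ k)) (at x)" for x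
      unfolding sum
      by (cases b) (auto simp: trig_def[abs_def] Some kb mult_ac intro!: derivative_eq_intros nth)
    moreover have "trig_polynomial (?D k)" for k
      by (intro trig_polynomial.intros)
    ultimately show ?thesis
      by (intro exI[of _ ?D]) blast
  qed
next
  case (add g h)
  then obtain D E where D: "\<And>k. trig_polynomial (D k)"
      "\<And>x. (g has_derivative (\<lambda>h. \<Sum>k\<in>UNIV. D k x * h $ k)) (at x)"
    and E: "\<And>k. trig_polynomial (E k)"
      "\<And>x. (h has_derivative (\<lambda>h. \<Sum>k\<in>UNIV. E k x * h $ k)) (at x)"
    by blast
  show ?case
  proof (intro exI[of _ "\<lambda>k x. D k x + E k x"] conjI allI)
    fix x
    show "((\<lambda>x. g x + h x) has_derivative (\<lambda>h. \<Sum>k\<in>UNIV. (D k x + E k x) * h $ k)) (at x)"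
      using has_derivative_add[OF D(2) E(2)] by (simp add: sum.distrib distrib_right)
  qed (intro trig_polynomial.add D E)
next
  case (mult g h)
  then obtain D E where D: "\<And>k. trig_polynomial (D k)"
      "\<And>x. (g has_derivative (\<lambda>h. \<Sum>k\<in>UNIV. D k x * h $ k)) (at x)"
    and E: "\<And>k. trig_polynomial (E k)"
      "\<And>x. (h has_derivative (\<lambda>h. \<Sum>k\<in>UNIV. E k x * h $ k)) (at x)"
    by blast
  show ?case
  proof (intro exI[of _ "\<lambda>k x. g x * E k x + D k x * h x"] conjI allI)
    fix x
    have "(\<Sum>k\<in>UNIV. (g x * E k x + D k x * h x) * v $ k)
      = g x * (\<Sum>k\<in>UNIV. E k x * v $ k) + (\<Sum>k\<in>UNIV. D k x * v $ k) * h x" for v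
      by (simp add: sum_distrib_left sum_distrib_right algebra_simps sum.distrib)
    then show "((\<lambda>x. g x * h x) has_derivative
        (\<lambda>v. \<Sum>k\<in>UNIV. (g x * E k x + D k x * h x) * v $ k)) (at x)"
      using has_derivative_mult[OF D(2)[of x] E(2)[of x]] by simp
  qed (intro trig_polynomial.intros D E mult.hyps)
qed

text \<open>Trigonometric polynomials with a fixed direction \<open>w\<close> are closed under partial derivatives, so their iterated
  partial derivatives are all differentiable.\<close>

lemma partial_derivs_trig_polynomial:
  assumes "trig_polynomial g"
  shows "\<exists>g'. trig_polynomial g' \<and> partial_derivs ks (\<lambda>x. g x *\<^sub>R w) = (\<lambda>x. g' x *\<^sub>R w)"
proof (induction ks)
  case Nil
  then show ?case using assms by auto
next
  case (Cons k ks)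
  then obtain g' where g': "trig_polynomial g'" "partial_derivs ks (\<lambda>x. g x *\<^sub>R w) = (\<lambda>x. g' x *\<^sub>R w)"
    by blast
  obtain D where D: "\<And>k. trig_polynomial (D k)"
      "\<And>x. (g' has_derivative (\<lambda>h. \<Sum>k\<in>UNIV. D k x * h $ k)) (at x)"
    using trig_polynomial_has_derivative[OF g'(1)] by blast
  have "partial_deriv k (\<lambda>x. g' x *\<^sub>R w) x = D k x *\<^sub>R w" for x
  proof -
    have "((\<lambda>x. g' x *\<^sub>R w) has_derivative (\<lambda>h. (\<Sum>k\<in>UNIV. D k x * h $ k) *\<^sub>R w)) (at x)"
      by (rule has_derivative_scaleR_left[OF D(2)])
    then have "partial_deriv k (\<lambda>x. g' x *\<^sub>R w) x = (\<Sum>j\<in>UNIV. D j x * axis k 1 $ j) *\<^sub>R w"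
      unfolding partial_deriv_def by (simp add: frechet_derivative_at[symmetric])
    also have "(\<Sum>j\<in>UNIV. D j x * axis k 1 $ j) = D k x"
      by (subst sum.remove[of _ k]) (auto simp: axis_def)
    finally show ?thesis .
  qed
  then show ?case
    using D(1) g'(2) by auto
qed

lemma lift_field_trig_polynomial:
  assumes "trig_polynomial g"
  shows "lift_field (\<lambda>y. g (rep_torus y) *\<^sub>R w) = (\<lambda>x. g x *\<^sub>R w)"
proof -
  have "g (rep_torus (abs_torus x)) = g x" for x
    by (rule trig_polynomial_periodic[OF assms])
      (metis Quotient_rep_abs Quotient_torus equivp_reflp equivp_torus_rel)
  then show ?thesis
    by (simp add: lift_field_def)
qed

lemma smooth_field_trig_polynomial:
  assumes "trig_polynomial g"
  shows "smooth_field (\<lambda>y. g (rep_torus y) *\<^sub>R w)"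
  unfolding smooth_field_def lift_field_trig_polynomial[OF assms]
proof
  fix ks
  obtain g' where g': "trig_polynomial g'" "partial_derivs ks (\<lambda>x. g x *\<^sub>R w) = (\<lambda>x. g' x *\<^sub>R w)"
    using partial_derivs_trig_polynomial[OF assms] by blast
  obtain D where "\<And>x. (g' has_derivative (\<lambda>h. \<Sum>k\<in>UNIV. D k x * h $ k)) (at x)"
    using trig_polynomial_has_derivative[OF g'(1)] by blast
  then show "partial_derivs ks (\<lambda>x. g x *\<^sub>R w) differentiable_on UNIV"
    unfolding g'(2) differentiable_on_def differentiable_def
    by (blast intro: has_derivative_scaleR_left)
qed

text \<open>The products run over all \<open>n\<close>-fold choices from the five functions, that is, over the monomials of degree at most
  \<open>n\<close>. Degree \<open>n\<close> is enough to write down a function vanishing at \<open>n - 1\<close> prescribed points.\<close>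

definition trig_field :: "('n::finite \<Rightarrow> (2 \<times> bool) option) \<times> 2 \<Rightarrow> torus \<Rightarrow> real^2" where
  "trig_field = (\<lambda>(s, k) y. (\<Prod>i\<in>UNIV. trig (s i) (rep_torus y)) *\<^sub>R axis k 1)"

lemma trig_polynomial_monomial: "trig_polynomial (\<lambda>x. \<Prod>i\<in>UNIV. trig (s (i::'n::finite)) x)"
  by (intro trig_polynomial_prod trig_polynomial.trig) auto

lemma smooth_trig_field: "smooth_field (trig_field l)"
  using smooth_field_trig_polynomial[OF trig_polynomial_monomial]
  by (cases l) (simp add: trig_field_def)

lemma lift_trig_field: "lift_field (trig_field (s, k)) = (\<lambda>x. (\<Prod>i\<in>UNIV. trig (s i) x) *\<^sub>R axis k 1)"
  using lift_field_trig_polynomial[OF trig_polynomial_monomial] by (simp add: trig_field_def)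

text \<open>The addition theorem for the cosine separates the two arguments.\<close>

lemma torus_gap_trig:
  "torus_gap x y = (\<Sum>t\<in>UNIV. (case t of None \<Rightarrow> 2 | Some k \<Rightarrow> - trig t y) * trig t x)"
proof -
  have "(\<Sum>t\<in>UNIV. (case t of None \<Rightarrow> 2 | Some k \<Rightarrow> - trig t y) * trig t x)
    = 2 + (\<Sum>kb\<in>UNIV. - trig (Some kb) y * trig (Some kb) x)"
    by (simp add: UNIV_option_conv sum.reindex trig_def[of None])
  also have "(\<Sum>kb\<in>UNIV. - trig (Some kb) y * trig (Some kb) x)
    = (\<Sum>k\<in>UNIV. \<Sum>b\<in>UNIV. - trig (Some (k, b)) y * trig (Some (k, b)) x)"
    by (simp add: sum.cartesian_product)
  also have "\<dots> = (\<Sum>k\<in>UNIV. - cos (x $ k - y $ k))"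
    by (rule sum.cong) (auto simp: UNIV_bool trig_def cos_diff)
  finally show ?thesis
    by (simp add: torus_gap_def sum_subtractf sum_negf)
qed

text \<open>Linear independence of the evaluations at distinct points, by Lagrange interpolation: the product over
  \<open>j \<noteq> i\<close> of the gaps to \<open>X $ j\<close> is a combination of the monomials which vanishes at every point but \<open>X $ i\<close>. Applied
  to it, the hypothesis leaves only the \<open>i\<close>-th summand.\<close>

lemma trig_monomials_interpolate:
  fixes X :: "real^2^'n" and v :: "real^'n"
  assumes sep: "\<And>i j. i \<noteq> j \<Longrightarrow> \<not> torus_rel (X $ i) (X $ j)"
    and zero: "\<And>s. (\<Sum>j\<in>UNIV. (\<Prod>i\<in>UNIV. trig (s (i::'n)) (X $ j)) * v $ j) = 0"
  shows "v = 0"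
proof -
  have "v $ i = 0" for i
  proof -
    \<comment> \<open>\<open>q j\<close> is the \<open>j\<close>-th factor of the interpolating product and \<open>c j\<close> are its coefficients in the functions \<open>trig t\<close>.\<close>
    define c where "c j t = (if j = i then if t = None then 1 else 0
      else case t of None \<Rightarrow> 2 | Some k \<Rightarrow> - trig t (X $ j))" for j t
    define q where "q j y = (if j = i then 1 else torus_gap y (X $ j))" for j y
    have q: "(\<Sum>t\<in>UNIV. c j t * trig t y) = q j y" for j y
    proof (cases "j = i")
      case True
      have "(\<Sum>t\<in>UNIV. c j t * trig t y) = c j None * trig None y + (\<Sum>t\<in>UNIV - {None}. c j t * trig t y)"
        by (rule sum.remove) auto
      also have "(\<Sum>t\<in>UNIV - {None}. c j t * trig t y) = 0"
        by (rule sum.neutral) (auto simp: c_def True)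
      finally show ?thesis
        by (simp add: q_def c_def True trig_def)
    qed (simp add: q_def c_def torus_gap_trig)
    have expand: "(\<Prod>j\<in>UNIV. q j y) = (\<Sum>s\<in>UNIV. (\<Prod>j\<in>UNIV. c j (s j)) * (\<Prod>j\<in>UNIV. trig (s j) y))" for y
      unfolding q[symmetric]
      by (subst prod_sum_PiE) (auto simp: prod.distrib)
    have "0 = (\<Sum>s\<in>UNIV. (\<Prod>j\<in>UNIV. c j (s j)) * (\<Sum>m\<in>UNIV. (\<Prod>j\<in>UNIV. trig (s j) (X $ m)) * v $ m))"
      by (simp add: zero)
    also have "\<dots> = (\<Sum>s\<in>UNIV. \<Sum>m\<in>UNIV. (\<Prod>j\<in>UNIV. c j (s j)) * (\<Prod>j\<in>UNIV. trig (s j) (X $ m)) * v $ m)"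
      by (simp add: sum_distrib_left mult.assoc)
    also have "\<dots> = (\<Sum>m\<in>UNIV. \<Sum>s\<in>UNIV. (\<Prod>j\<in>UNIV. c j (s j)) * (\<Prod>j\<in>UNIV. trig (s j) (X $ m)) * v $ m)"
      by (rule sum.swap)
    also have "\<dots> = (\<Sum>m\<in>UNIV. (\<Prod>j\<in>UNIV. q j (X $ m)) * v $ m)"
      by (simp add: expand sum_distrib_right)
    also have "\<dots> = (\<Prod>j\<in>UNIV. q j (X $ i)) * v $ i + (\<Sum>m\<in>UNIV - {i}. (\<Prod>j\<in>UNIV. q j (X $ m)) * v $ m)"
      by (rule sum.remove) auto
    also have "(\<Sum>m\<in>UNIV - {i}. (\<Prod>j\<in>UNIV. q j (X $ m)) * v $ m) = 0"
    proof (intro sum.neutral ballI)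
      fix m assume "m \<in> UNIV - {i}"
      moreover have "torus_gap (X $ m) (X $ m) = 0"
        by (simp add: torus_gap_def)
      ultimately have "q m (X $ m) = 0"
        by (simp add: q_def)
      then have "(\<Prod>j\<in>UNIV. q j (X $ m)) = 0"
        by (intro prod_zero) auto
      then show "(\<Prod>j\<in>UNIV. q j (X $ m)) * v $ m = 0"
        by simp
    qed
    finally have "(\<Prod>j\<in>UNIV. q j (X $ i)) * v $ i = 0"
      by simp
    moreover have "q j (X $ i) \<noteq> 0" for j
      using sep[of i j] by (auto simp: q_def torus_gap_eq_0_iff)
    ultimately show ?thesis
      by simp
  qed
  then show ?thesis
    by (simp add: vec_eq_iff)
qed

section \<open>Spanning at a configuration of points\<close>

text \<open>Configurations on the torus are handled through their lifts to the plane, where compactness and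
  differentiability are those of a Euclidean space.\<close>

definition torus_proj :: "real^2^'n \<Rightarrow> torus^'n" where
  "torus_proj X = (\<chi> j. abs_torus (X $ j))"

lemma diag_field_proj: "diag_field f (torus_proj X) = (\<chi> j. lift_field f (X $ j))"
  by (simp add: diag_field_def torus_proj_def lift_field_def)

lemma span_eq_UNIV_iff_orthogonal:
  fixes S :: "'a::euclidean_space set"
  shows "span S = UNIV \<longleftrightarrow> (\<forall>v. v \<noteq> 0 \<longrightarrow> (\<exists>s\<in>S. v \<bullet> s \<noteq> 0))"
proof
  assume S: "span S = UNIV"
  show "\<forall>v. v \<noteq> 0 \<longrightarrow> (\<exists>s\<in>S. v \<bullet> s \<noteq> 0)"
  proof (intro allI impI, rule ccontr)
    fix v :: 'a assume "v \<noteq> 0" and "\<not> (\<exists>s\<in>S. v \<bullet> s \<noteq> 0)"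
    then have "orthogonal v s" if "s \<in> S" for s
      using that by (auto simp: orthogonal_def)
    then have "orthogonal v v"
      using orthogonal_to_span[of v S v] S by blast
    with \<open>v \<noteq> 0\<close> show False
      by (simp add: orthogonal_self)
  qed
next
  assume "\<forall>v. v \<noteq> 0 \<longrightarrow> (\<exists>s\<in>S. v \<bullet> s \<noteq> 0)"
  then show "span S = UNIV"
    using span_not_UNIV_orthogonal[of S] by (metis span_base)
qed

text \<open>The dual description of spanning, which turns it into solvability of scalar equations.\<close>

definition spans_at :: "'i set \<Rightarrow> ('i \<Rightarrow> torus \<Rightarrow> real^2) \<Rightarrow> real^2^'n \<Rightarrow> bool" where
  "spans_at I f X \<longleftrightarrow> (\<forall>v. v \<noteq> 0 \<longrightarrow> (\<exists>a\<in>I. v \<bullet> diag_field (f a) (torus_proj X) \<noteq> 0))"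

lemma spans_at_iff_span:
  "spans_at I f X \<longleftrightarrow> span ((\<lambda>a. diag_field (f a) (torus_proj X)) ` I) = UNIV"
  by (simp add: span_eq_UNIV_iff_orthogonal spans_at_def)

lemma smooth_field_lift_differentiable:
  assumes "smooth_field f"
  shows "lift_field f differentiable (at x)"
  using assms[unfolded smooth_field_def, rule_format, of "[]"] by (simp add: differentiable_on_def)

lemma differentiable_inner_diag_field:
  assumes "smooth_field f"
  shows "(\<lambda>z::(real^2^'n) \<times> (real^2^'n). snd z \<bullet> diag_field f (torus_proj (fst z))) differentiable (at z)"
proof -
  have "bounded_linear (\<lambda>z::(real^2^'n) \<times> (real^2^'n). fst z $ j)"
    "bounded_linear (\<lambda>z::(real^2^'n) \<times> (real^2^'n). snd z $ j)" for j
    by (rule bounded_linear_compose[OF bounded_linear_vec_nth] bounded_linear_fst bounded_linear_snd)+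
  then have "(\<lambda>z::(real^2^'n) \<times> (real^2^'n). snd z $ j \<bullet> lift_field f (fst z $ j)) differentiable (at z)" for j
    by (intro differentiable_inner differentiable_compose[OF smooth_field_lift_differentiable[OF assms]]
      bounded_linear_imp_differentiable)
  then show ?thesis
    by (simp add: diag_field_proj inner_vec_def differentiable_sum)
qed

lemma inner_diag_trig_field:
  "v \<bullet> diag_field (trig_field (s, k)) (torus_proj X) = (\<Sum>j\<in>UNIV. (\<Prod>i\<in>UNIV. trig (s i) (X $ j)) * v $ j $ k)"
  by (simp add: diag_field_proj lift_trig_field inner_vec_def[of v] inner_axis)

text \<open>The \<open>k\<close>-th components of a covector orthogonal to all these fields satisfy the hypothesis of the interpolation
  lemma, for each of the two coordinate directions \<open>k\<close>.\<close>

lemma trig_fields_span: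
  fixes X :: "real^2^'n"
  assumes "\<And>i j. i \<noteq> j \<Longrightarrow> \<not> torus_rel (X $ i) (X $ j)"
  shows "spans_at (UNIV :: (('n \<Rightarrow> (2 \<times> bool) option) \<times> 2) set) trig_field X"
  unfolding spans_at_def
proof (intro allI impI, rule ccontr)
  fix v :: "real^2^'n"
  assume "v \<noteq> 0" and zero: "\<not> (\<exists>l\<in>(UNIV :: (('n \<Rightarrow> (2 \<times> bool) option) \<times> 2) set). v \<bullet> diag_field (trig_field l) (torus_proj X) \<noteq> 0)"
  have "(\<chi> j. v $ j $ k) = 0" for k
    using zero by (intro trig_monomials_interpolate[OF assms]) (auto simp: inner_diag_trig_field[symmetric])
  then have "v = 0"
    by (simp add: vec_eq_iff)
  with \<open>v \<noteq> 0\<close> show False ..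
qed

section \<open>Openness on compact sets of configurations\<close>

text \<open>Compactness bounds \<open>\<Sum>\<bar>v \<bullet> A_f(x)\<bar>\<close> from below by some \<open>\<delta> > 0\<close> over all \<open>x\<close> in \<open>K\<close> and unit vectors \<open>v\<close>. A family so
  close to \<open>f\<close> in the supremum norm that this sum changes by less than \<open>\<delta>\<close> still spans on \<open>K\<close>.\<close>

lemma openin_spans_at_compact:
  fixes K :: "(real^2^'n) set"
  assumes K: "compact K" and I: "finite I"
  shows "openin (product_topology (\<lambda>_. smooth_fields_topology) I)
    {f \<in> I \<rightarrow>\<^sub>E Collect smooth_field. \<forall>X\<in>K. spans_at I f X}"
proof (subst openin_subopen, intro ballI)
  fix f assume "f \<in> {f \<in> I \<rightarrow>\<^sub>E Collect smooth_field. \<forall>X\<in>K. spans_at I f X}"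
  then have f: "f \<in> I \<rightarrow>\<^sub>E Collect smooth_field" and span: "\<And>X. X \<in> K \<Longrightarrow> spans_at I f X"
    by auto
  have smooth: "smooth_field (f a)" if "a \<in> I" for a
    using f that by auto
  define \<Phi> where "\<Phi> z = (\<Sum>a\<in>I. \<bar>snd z \<bullet> diag_field (f a) (torus_proj (fst z))\<bar>)" for z :: "(real^2^'n) \<times> (real^2^'n)"
  have "continuous_on UNIV \<Phi>"
    unfolding \<Phi>_def[abs_def]
    by (intro continuous_intros differentiable_imp_continuous_on)
      (auto simp: differentiable_on_def intro: differentiable_inner_diag_field smooth)
  then have cont: "continuous_on (K \<times> sphere 0 1) \<Phi>"
    by (rule continuous_on_subset) simp
  have pos: "0 < \<Phi> z" if z: "z \<in> K \<times> sphere 0 1" for z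
  proof -
    have "snd z \<noteq> 0" "fst z \<in> K"
      using z by auto
    then obtain a where "a \<in> I" "snd z \<bullet> diag_field (f a) (torus_proj (fst z)) \<noteq> 0"
      using span unfolding spans_at_def by blast
    then show ?thesis
      unfolding \<Phi>_def by (intro sum_pos2[OF I]) auto
  qed
  obtain \<delta> where \<delta>: "0 < \<delta>" "\<And>z. z \<in> K \<times> sphere 0 1 \<Longrightarrow> \<delta> \<le> \<Phi> z"
  proof (cases "K \<times> sphere 0 (1::real) = ({} :: ((real^2^'n) \<times> (real^2^'n)) set)")
    case True
    then show ?thesis
      using that[of 1] by simp
  next
    case False
    obtain z where "z \<in> K \<times> sphere 0 1" "\<forall>y\<in>K \<times> sphere 0 1. \<Phi> z \<le> \<Phi> y"
      using continuous_attains_inf[OF compact_Times[OF K compact_sphere] False cont] by blast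
    then show ?thesis
      using that[of "\<Phi> z"] pos by blast
  qed
  define \<eta> where "\<eta> = \<delta> / (card I * CARD('n) + 1)"
  have \<eta>: "0 < \<eta>" "card I * CARD('n) * \<eta> < \<delta>"
    using \<delta>(1) by (auto simp: \<eta>_def field_simps add_pos_nonneg)
  let ?T = "\<Pi>\<^sub>E a\<in>I. Ck_ball (f a) 0 \<eta>"
  have "openin smooth_fields_topology (Ck_ball (f a) 0 \<eta>)" if "a \<in> I" for a
    unfolding smooth_fields_topology_def
    by (rule topology_generated_by_Basis) (use smooth that \<eta>(1) in auto)
  then have "openin (product_topology (\<lambda>_. smooth_fields_topology) I) ?T"
    using I by (simp add: openin_PiE_gen)
  moreover have "f \<in> ?T"
    using f \<eta>(1) by (auto simp: Ck_ball_def Ck_norm_zero PiE_iff)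
  moreover have "?T \<subseteq> {f \<in> I \<rightarrow>\<^sub>E Collect smooth_field. \<forall>X\<in>K. spans_at I f X}"
  proof
    fix g assume g: "g \<in> ?T"
    then have g_smooth: "smooth_field (g a)" and g_near: "Ck_norm 0 (\<lambda>x. g a x - f a x) < \<eta>" if "a \<in> I" for a
      using that by (auto simp: Ck_ball_def PiE_iff)
    have "spans_at I g X" if X: "X \<in> K" for X
      unfolding spans_at_def
    proof (intro allI impI, rule ccontr)
      fix v :: "real^2^'n"
      assume v: "v \<noteq> 0" and none: "\<not> (\<exists>a\<in>I. v \<bullet> diag_field (g a) (torus_proj X) \<noteq> 0)"
      define u where "u = v /\<^sub>R norm v"
      have u: "norm u = 1"
        using v by (simp add: u_def)
      have zero: "u \<bullet> diag_field (g a) (torus_proj X) = 0" if "a \<in> I" for a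
        using that none by (auto simp: u_def)
      have "\<bar>u \<bullet> diag_field (f a) (torus_proj X)\<bar> \<le> CARD('n) * \<eta>" if a: "a \<in> I" for a
      proof -
        let ?d = "\<lambda>x. g a x - f a x"
        have d: "smooth_field ?d"
          using smooth_field_diff g_smooth smooth a by blast
        have diff: "diag_field ?d (torus_proj X) = diag_field (g a) (torus_proj X) - diag_field (f a) (torus_proj X)"
          by (simp add: diag_field_def vec_eq_iff)
        have "u \<bullet> diag_field (f a) (torus_proj X) = - (u \<bullet> diag_field ?d (torus_proj X))"
          using zero[OF a] by (simp add: diff inner_diff_right)
        then have "\<bar>u \<bullet> diag_field (f a) (torus_proj X)\<bar> \<le> norm u * norm (diag_field ?d (torus_proj X))"
          using Cauchy_Schwarz_ineq2[of u "diag_field ?d (torus_proj X)"] by simp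
        also have "\<dots> \<le> (\<Sum>j\<in>UNIV. norm (lift_field ?d (X $ j)))"
          using L2_set_le_sum[of UNIV "\<lambda>j. norm (lift_field ?d (X $ j))"]
          by (simp add: u diag_field_proj norm_vec_def[of "\<chi> j. lift_field ?d (X $ j)"])
        also have "\<dots> \<le> (\<Sum>j\<in>(UNIV :: 'n set). \<eta>)"
          using norm_partial_derivs_le_Ck_norm[OF d, of "[]" 0] g_near[OF a]
          by (intro sum_mono) (auto intro: order_trans less_imp_le)
        finally show ?thesis
          by simp
      qed
      then have "\<Phi> (X, u) \<le> (\<Sum>a\<in>I. CARD('n) * \<eta>)"
        unfolding \<Phi>_def by (intro sum_mono) simp
      also have "\<dots> < \<delta>"
        using \<eta>(2) by (simp add: mult.assoc)
      also have "\<delta> \<le> \<Phi> (X, u)"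
        using X u by (intro \<delta>(2)) simp
      finally show False by simp
    qed
    then show "g \<in> {f \<in> I \<rightarrow>\<^sub>E Collect smooth_field. \<forall>X\<in>K. spans_at I f X}"
      using g g_smooth by (auto simp: PiE_iff)
  qed
  ultimately show "\<exists>T. openin (product_topology (\<lambda>_. smooth_fields_topology) I) T \<and> f \<in> T \<and>
      T \<subseteq> {f \<in> I \<rightarrow>\<^sub>E Collect smooth_field. \<forall>X\<in>K. spans_at I f X}"
    by blast
qed

section \<open>Density\<close>

text \<open>The unknown \<open>(x, v)\<close> has \<open>4n\<close> real coordinates, so perturbing \<open>4n + 1\<close> of the fields independently makes the
  system \<open>v \<bullet> A(x) = 0\<close> unsolvable for almost every choice of coefficients. The same coefficients serve all
  configurations of distinct points at once.\<close>

lemma dense_spans_at_distinct: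
  assumes I: "finite I" "4 * CARD('n::finite) < card I"
  shows "product_topology (\<lambda>_. smooth_fields_topology) I closure_of
      {f \<in> I \<rightarrow>\<^sub>E Collect smooth_field. \<forall>X :: real^2^'n.
        (\<forall>i j. i \<noteq> j \<longrightarrow> \<not> torus_rel (X $ i) (X $ j)) \<longrightarrow> spans_at I f X}
    = topspace (product_topology (\<lambda>_. smooth_fields_topology) I)"
  (is "?P closure_of ?D = _")
proof (subst dense_intersects_open, intro allI impI)
  fix T assume "openin ?P T \<and> T \<noteq> {}"
  then obtain f where T: "openin ?P T" and f: "f \<in> T"
    by auto
  then have "f \<in> topspace ?P"
    using openin_subset by blast
  then have f_PiE: "f \<in> I \<rightarrow>\<^sub>E Collect smooth_field"
    by (simp add: topspace_smooth_fields)
  have "card (UNIV :: ('n \<times> 4) option set) \<le> card I"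
    using I by simp
  \<comment> \<open>The type \<open>('n \<times> 4) option\<close> has \<open>4n + 1\<close> elements; \<open>e\<close> selects the fields that are perturbed.\<close>
  then obtain e :: "('n \<times> 4) option \<Rightarrow> 'a" where e: "range e \<subseteq> I" "inj e"
    using card_le_inj[OF finite I(1)] by blast
  let ?L = "UNIV :: (('n \<Rightarrow> (2 \<times> bool) option) \<times> 2) set"
  define G where "G c = restrict (\<lambda>a. if a \<in> range e
      then (\<lambda>x. f a x + (\<Sum>l\<in>?L. c $ inv e a $ l *\<^sub>R trig_field l x)) else f a) I"
    for c :: "real^(('n \<Rightarrow> (2 \<times> bool) option) \<times> 2)^(('n \<times> 4) option)"
  have G_cont: "continuous_map euclidean ?P G"
    unfolding continuous_map_componentwise
  proof (intro conjI ballI)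
    fix a assume a: "a \<in> I"
    then have fa: "smooth_field (f a)"
      using f_PiE by auto
    show "continuous_map euclidean smooth_fields_topology (\<lambda>c. G c a)"
    proof (cases "a \<in> range e")
      case True
      have "continuous_on UNIV (\<lambda>c. c $ inv e a)"
        by (intro continuous_intros)
      then have "continuous_map euclidean euclidean (\<lambda>c. c $ inv e a)"
        by simp
      from continuous_map_compose[OF this continuous_map_smooth_fields_perturbation[OF fa smooth_trig_field]]
      show ?thesis
        using True a by (simp add: G_def o_def)
    qed (use a fa in \<open>simp add: G_def topspace_smooth_fields\<close>)
  qed (auto simp: G_def)
  define W where "W = {c. G c \<in> T}"
  have "open W"
    using openin_continuous_map_preimage[OF G_cont T] by (simp add: W_def)
  moreover have "G 0 = f"
    using f_PiE by (auto simp: G_def restrict_def PiE_iff extensional_def fun_eq_iff)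
  then have "W \<noteq> {}"
    using f by (auto simp: W_def)
  ultimately have "\<not> negligible W"
    by (rule open_not_negligible)
  let ?\<alpha> = "\<lambda>p (z :: (real^2^'n) \<times> (real^2^'n)). snd z \<bullet> diag_field (f (e p)) (torus_proj (fst z))"
  let ?\<beta> = "\<lambda>(l :: ('n \<Rightarrow> (2 \<times> bool) option) \<times> 2) (z :: (real^2^'n) \<times> (real^2^'n)). snd z \<bullet> diag_field (trig_field l) (torus_proj (fst z))"
  define B where "B = {c :: real^(('n \<Rightarrow> (2 \<times> bool) option) \<times> 2)^(('n \<times> 4) option).
      \<exists>z. (\<exists>l. ?\<beta> l z \<noteq> 0) \<and> (\<forall>p. ?\<alpha> p z + (\<Sum>l\<in>UNIV. c $ p $ l * ?\<beta> l z) = 0)}"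
  have "negligible B"
    unfolding B_def
  proof (rule negligible_solvable_parameters)
    show "?\<alpha> p differentiable (at z)" for p z
      by (rule differentiable_inner_diag_field) (use f_PiE e in auto)
    show "?\<beta> l differentiable (at z)" for l z
      by (rule differentiable_inner_diag_field) (rule smooth_trig_field)
  qed simp
  with \<open>\<not> negligible W\<close> have "\<not> W \<subseteq> B"
    using negligible_subset by blast
  then obtain c where c: "G c \<in> T" "c \<notin> B"
    unfolding W_def by blast
  have "spans_at I (G c) X" if X: "\<forall>i j. i \<noteq> j \<longrightarrow> \<not> torus_rel (X $ i) (X $ j)" for X :: "real^2^'n"
    unfolding spans_at_def
  proof (intro allI impI)
    fix v :: "real^2^'n" assume "v \<noteq> 0"
    then obtain l :: "('n \<Rightarrow> (2 \<times> bool) option) \<times> 2" where "?\<beta> l (X, v) \<noteq> 0"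
      using trig_fields_span[of X] X unfolding spans_at_def by auto
    then obtain p where p: "?\<alpha> p (X, v) + (\<Sum>l\<in>UNIV. c $ p $ l * ?\<beta> l (X, v)) \<noteq> 0"
      using c(2) unfolding B_def by blast
    have "diag_field (G c (e p)) (torus_proj X) = diag_field (f (e p)) (torus_proj X)
        + (\<Sum>l\<in>UNIV. c $ p $ l *\<^sub>R diag_field (trig_field l) (torus_proj X))"
      using e by (simp add: G_def diag_field_def vec_eq_iff image_subset_iff)
    then have "v \<bullet> diag_field (G c (e p)) (torus_proj X) \<noteq> 0"
      using p by (simp add: inner_add_right inner_sum_right)
    then show "\<exists>a\<in>I. v \<bullet> diag_field (G c a) (torus_proj X) \<noteq> 0"
      using e(1) by blast
  qed
  moreover have "G c \<in> topspace ?P"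
    using c(1) T openin_subset by blast
  then have "G c \<in> I \<rightarrow>\<^sub>E Collect smooth_field"
    by (simp add: topspace_smooth_fields)
  ultimately show "?D \<inter> T \<noteq> {}"
    using c(1) by blast
qed

section \<open>Exhausting the complement of the fat diagonal\<close>

text \<open>The points stay in a closed fundamental square and keep pairwise gaps bounded below, which makes the set
  compact; the bound tends to \<open>0\<close> with \<open>m\<close>, so that these sets exhaust the complement of the fat diagonal.\<close>

definition separated_points :: "nat \<Rightarrow> (real^2^'n) set" where
  "separated_points m = {X \<in> cbox 0 (\<chi> j k. 2 * pi). \<forall>i j. i \<noteq> j \<longrightarrow> inverse (Suc m) \<le> torus_gap (X $ i) (X $ j)}"

lemma compact_separated_points: "compact (separated_points m)"
proof -
  have "closed {X :: real^2^'n. \<forall>i j. i \<noteq> j \<longrightarrow> inverse (Suc m) \<le> torus_gap (X $ i) (X $ j)}"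
    unfolding torus_gap_def
    by (intro closed_Collect_all closed_Collect_imp open_Collect_const closed_Collect_le continuous_intros)
  then have "compact (cbox 0 (\<chi> j k. 2 * pi) \<inter> {X :: real^2^'n. \<forall>i j. i \<noteq> j \<longrightarrow> inverse (Suc m) \<le> torus_gap (X $ i) (X $ j)})"
    by (intro compact_Int_closed compact_cbox)
  then show ?thesis
    by (simp add: separated_points_def Int_def)
qed

lemma separated_points_distinct:
  assumes "X \<in> separated_points m" "i \<noteq> j"
  shows "\<not> torus_rel (X $ i) (X $ j)"
proof
  assume "torus_rel (X $ i) (X $ j)"
  then have "torus_gap (X $ i) (X $ j) = 0"
    by (simp add: torus_gap_eq_0_iff)
  moreover have "inverse (Suc m) \<le> torus_gap (X $ i) (X $ j)"
    using assms unfolding separated_points_def by blast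
  ultimately show False
    by (simp del: of_nat_Suc)
qed

lemma off_diagonal_separated:
  fixes x :: "torus^'n"
  assumes "x \<notin> fat_diagonal"
  obtains m X where "X \<in> separated_points m" "torus_proj X = x"
proof -
  have "\<exists>y. abs_torus y = x $ j \<and> y \<in> cbox 0 (\<chi> k. 2 * pi)" for j
  proof -
    obtain y where y: "torus_rel (rep_torus (x $ j)) y" "y \<in> cbox 0 (\<chi> k. 2 * pi)"
      by (rule fundamental_domain)
    then show ?thesis
      using abs_torus_cong[OF y(1)] by (metis Quotient_abs_rep Quotient_torus)
  qed
  then obtain Y where Y: "\<And>j. abs_torus (Y j) = x $ j" "\<And>j. Y j \<in> cbox 0 (\<chi> k. 2 * pi)"
    by metis
  define X where "X = (\<chi> j. Y j)"
  \<comment> \<open>The extra element keeps the set nonempty when \<open>'n\<close> has a single element and there are no pairs.\<close>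
  let ?S = "insert 1 ((\<lambda>(i, j). torus_gap (Y i) (Y j)) ` {(i, j). i \<noteq> j})"
  have "0 < torus_gap (Y i) (Y j)" if "i \<noteq> j" for i j
  proof -
    have "x $ i \<noteq> x $ j"
      using assms that by (auto simp: fat_diagonal_def)
    then have "\<not> torus_rel (Y i) (Y j)"
      using abs_torus_cong Y(1) by metis
    then show ?thesis
      using torus_gap_nonneg[of "Y i" "Y j"] torus_gap_eq_0_iff[of "Y i" "Y j"] by simp
  qed
  moreover have fin: "finite ?S"
    by simp
  ultimately have "0 < Min ?S"
    by (subst Min_gr_iff) auto
  then obtain m where m: "inverse (Suc m) < Min ?S"
    using reals_Archimedean by blast
  have "inverse (Suc m) \<le> torus_gap (Y i) (Y j)" if "i \<noteq> j" for i j
  proof -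
    have "Min ?S \<le> torus_gap (Y i) (Y j)"
      using that by (intro Min_le fin) auto
    with m show ?thesis by (rule less_imp_le[OF less_le_trans])
  qed
  moreover have "X \<in> cbox 0 (\<chi> j k. 2 * pi)"
    using Y(2) by (auto simp: X_def mem_box Basis_vec_def inner_axis)
  ultimately have "X \<in> separated_points m"
    by (simp add: separated_points_def X_def)
  moreover have "torus_proj X = x"
    by (simp add: torus_proj_def X_def Y vec_eq_iff)
  ultimately show ?thesis
    by (rule that)
qed

section \<open>The residual set\<close>

theorem theorem10:
  fixes M :: nat
  assumes "M > 2 * CARD('n::finite)"
  shows "\<exists>Q. residual_in
              (product_topology (\<lambda>_. smooth_fields_topology) ({1..M} \<times> {1..2 * CARD('n)})) Q
           \<and> (\<forall>f\<in>Q. \<forall>x :: torus^'n. x \<in> - fat_diagonal \<longrightarrow>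
                span {diag_field (f (a, i)) x |a i. a \<in> {1..M} \<and> i \<in> {1..2 * CARD('n)}} = UNIV)"
proof -
  define I where "I = {1..M} \<times> {1..2 * CARD('n)}"
  let ?P = "product_topology (\<lambda>_. smooth_fields_topology) I"
  define U where "U m = {f \<in> I \<rightarrow>\<^sub>E Collect smooth_field. \<forall>X\<in>separated_points m :: (real^2^'n) set. spans_at I f X}" for m
  have n: "0 < CARD('n)"
    by simp
  \<comment> \<open>\<open>M > 2n \<ge> 2\<close> gives \<open>M \<ge> 3\<close>, so the number of fields is \<open>2nM \<ge> 6n > 4n\<close>.\<close>
  have "3 * (2 * CARD('n)) \<le> M * (2 * CARD('n))"
    using assms n by (intro mult_right_mono) linarith+
  then have card: "4 * CARD('n) < card I"
    using n by (simp add: I_def)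
  have fin: "finite I"
    by (simp add: I_def)
  have "openin ?P (U m)" for m
    unfolding U_def by (rule openin_spans_at_compact[OF compact_separated_points fin])
  moreover have "?P closure_of (U m) = topspace ?P" for m
  proof (rule antisym[OF closure_of_subset_topspace])
    have "?P closure_of {f \<in> I \<rightarrow>\<^sub>E Collect smooth_field. \<forall>X :: real^2^'n.
        (\<forall>i j. i \<noteq> j \<longrightarrow> \<not> torus_rel (X $ i) (X $ j)) \<longrightarrow> spans_at I f X} \<subseteq> ?P closure_of (U m)"
      unfolding U_def using separated_points_distinct by (intro closure_of_mono) blast
    then show "topspace ?P \<subseteq> ?P closure_of (U m)"
      by (simp only: dense_spans_at_distinct[OF fin card])
  qed
  ultimately have "residual_in ?P (topspace ?P \<inter> \<Inter> (range U))"
    unfolding residual_in_def by (intro exI[of _ "range U"] conjI countable_image countableI_type refl ballI) blast+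
  moreover have "span {diag_field (f (a, i)) x |a i. a \<in> {1..M} \<and> i \<in> {1..2 * CARD('n)}} = UNIV"
    if f: "f \<in> topspace ?P \<inter> \<Inter> (range U)" and x: "x \<in> - fat_diagonal" for f and x :: "torus^'n"
  proof -
    from x have "x \<notin> fat_diagonal"
      by simp
    then obtain m X where X: "X \<in> separated_points m" "torus_proj X = x"
      by (rule off_diagonal_separated)
    have "f \<in> U m"
      using f by blast
    then have "spans_at I f X"
      using X(1) by (simp add: U_def)
    moreover have "(\<lambda>a. diag_field (f a) x) ` I
        = {diag_field (f (a, i)) x |a i. a \<in> {1..M} \<and> i \<in> {1..2 * CARD('n)}}"
      unfolding I_def image_def by (rule Collect_cong) (simp only: bex_simps Bex_def mem_Sigma_iff split_paired_Ex, blast)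
    ultimately show ?thesis
      by (simp add: spans_at_iff_span X(2))
  qed
  ultimately show ?thesis
    unfolding I_def[symmetric] by blast
qed

end
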